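(* Let $c>0$ and $1\le\alpha\le2$ be constants, and let $G$ be a graph with $m$ edges such that $e(G[S])\le c|S|^{\alpha}$ for every $S\subseteq V(G)$. Then for each $\tau\in(0,1)$ there is a constant $C>0$ (depending only on $c,\alpha,\tau$) such that \[ \sum_{v\in V(G)}d_G(v)^\tau\ge C\, m^{\tau+\frac{1-\tau}{\alpha}}. \]
   Context: $G[S]$ denotes the subgraph induced by $S$, $e(\cdot)$ the number of edges, and $d_G(v)$ the degree of $v$ in $G$. *)

theory Defs
  imports Complex_Main
begin

type_synonym 'a graph = "'a set \<times> 'a set set"

abbreviation verts :: "'a graph \<Rightarrow> 'a set" where
  "verts G \<equiv> fst G"

abbreviation edges :: "'a graph \<Rightarrow> 'a set set" where
  "edges G \<equiv> snd G"

definition finite_simple_graph :: "'a graph \<Rightarrow> bool" where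
  "finite_simple_graph G \<longleftrightarrow>
     finite (verts G) \<and> (\<forall>e\<in>edges G. e \<subseteq> verts G \<and> card e = 2)"

definition induced_subgraph :: "'a graph \<Rightarrow> 'a set \<Rightarrow> 'a graph" where
  "induced_subgraph G S = (S, {e \<in> edges G. e \<subseteq> S})"

definition num_edges :: "'a graph \<Rightarrow> nat" where
  "num_edges G = card (edges G)"

definition degree :: "'a graph \<Rightarrow> 'a \<Rightarrow> nat" where
  "degree G v = card {e \<in> edges G. v \<in> e}"

text \<open>
  HOL cannot quantify over vertex types inside a formula. A statement
  "there is C such that for all graphs G of type 'a graph" is to be read for
  every 'a; since every finite graph is isomorphic to one with vertices in nat,
  the constant obtained for the instance 'a = nat serves all finite graphs at once.

  Powers with real exponent use powr, where 0 powr x = 0. All exponents that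
  occur are positive, so isolated vertices, empty vertex sets and edgeless graphs
  get the usual value 0.
\<close>

end

(* Call a vertex heavy if its degree exceeds D = K m^(1 - 1/alpha). By the handshake lemma there are
   at most 2m/D heavy vertices, so for a suitable K the sparsity hypothesis leaves at most m/2 edges
   between heavy vertices. The light vertices meet all other edges, hence their degrees sum
   to at least m/2, and d^tau >= D^(tau-1) d for each light degree d. *)
theory Submission
  imports Defs
begin

lemma finite_edges:
  assumes "finite_simple_graph G"
  shows "finite (edges G)"
  using assms unfolding finite_simple_graph_def
  by (meson PowI finite_Pow_iff finite_subset subsetI)

text \<open>Double counting of incident pairs (vertex, edge): every edge has exactly two endpoints,
  both in the graph.\<close>

lemma sum_degree:
  assumes "finite_simple_graph G"
  shows "(\<Sum>v\<in>verts G. degree G v) = 2 * num_edges G"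
  unfolding degree_def num_edges_def
proof (rule sum_multicount)
  show "\<forall>e\<in>edges G. card {v \<in> verts G. v \<in> e} = 2"
  proof
    fix e assume "e \<in> edges G"
    then have "e \<subseteq> verts G" "card e = 2"
      using assms by (auto simp: finite_simple_graph_def)
    then show "card {v \<in> verts G. v \<in> e} = 2"
      by (metis Int_absorb1 Int_def)
  qed
qed (use assms finite_edges[OF assms] in \<open>auto simp: finite_simple_graph_def\<close>)

text \<open>Markov's inequality for the degree sequence, whose total is known from
  \<open>sum_degree\<close>.\<close>

lemma card_high_degree_le:
  fixes D :: real
  assumes "finite_simple_graph G"
  shows "real (card {v \<in> verts G. D < real (degree G v)}) * D \<le> 2 * real (num_edges G)"
proof -
  let ?H = "{v \<in> verts G. D < real (degree G v)}"
  have "real (card ?H) * D \<le> (\<Sum>v\<in>?H. real (degree G v))"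
    by (rule sum_bounded_below) auto
  also have "\<dots> \<le> (\<Sum>v\<in>verts G. real (degree G v))"
    using assms by (intro sum_mono2) (auto simp: finite_simple_graph_def)
  also have "\<dots> = 2 * real (num_edges G)"
    using sum_degree[OF assms] by (metis of_nat_mult of_nat_numeral of_nat_sum)
  finally show ?thesis .
qed

text \<open>An edge not contained in \<open>S\<close> has an endpoint outside \<open>S\<close> and
  is counted in the degree of that endpoint. Edges with both ends outside are counted twice, hence
  only an inequality.\<close>

lemma num_edges_le_induced_plus_sum_degree:
  assumes "finite_simple_graph G"
  shows "num_edges G \<le> num_edges (induced_subgraph G S) + (\<Sum>v\<in>verts G - S. degree G v)"
proof -
  let ?A = "{e \<in> edges G. e \<subseteq> S}"
  let ?B = "\<Union>v\<in>verts G - S. {e \<in> edges G. v \<in> e}"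
  have fin: "finite (verts G)" "finite (edges G)"
    using assms finite_edges[OF assms] by (auto simp: finite_simple_graph_def)
  have "edges G \<subseteq> ?A \<union> ?B"
    using assms by (fastforce simp: finite_simple_graph_def)
  then have "card (edges G) \<le> card (?A \<union> ?B)"
    using fin by (intro card_mono) auto
  also have "\<dots> \<le> card ?A + card ?B"
    by (rule card_Un_le)
  also have "card ?B \<le> (\<Sum>v\<in>verts G - S. degree G v)"
    unfolding degree_def using fin by (intro card_UN_le) auto
  finally show ?thesis
    by (simp add: num_edges_def induced_subgraph_def)
qed

lemma powr_ge_linear:
  fixes x D t :: real
  assumes "0 \<le> x" "x \<le> D" "t \<le> 1"
  shows "D powr (t - 1) * x \<le> x powr t"
\<comment> \<open>For positive \<open>x\<close>, split off one factor \<open>x\<close>: the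
  remaining exponent \<open>t - 1\<close> is at most 0, so the power is antitone in its base. At 0
  this monotonicity fails, because \<open>0 powr (t - 1)\<close> is 0, but there both sides
  vanish.\<close>
proof (cases "x = 0")
  case False
  then have "D powr (t - 1) * x \<le> x powr (t - 1) * x"
    using assms by (intro mult_right_mono powr_mono2') auto
  also have "\<dots> = x powr t"
    using False assms by (simp add: powr_mult_base mult.commute)
  finally show ?thesis .
qed simp

theorem theorem4p1:
  fixes c \<alpha> \<tau> :: real
  assumes "c > 0" and "1 \<le> \<alpha>" and "\<alpha> \<le> 2" and "0 < \<tau>" and "\<tau> < 1"
  shows "\<exists>C>0. \<forall>G :: 'a graph.
           finite_simple_graph G \<longrightarrow>
           (\<forall>S \<subseteq> verts G. real (num_edges (induced_subgraph G S)) \<le> c * real (card S) powr \<alpha>) \<longrightarrow>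
           (\<Sum>v\<in>verts G. real (degree G v) powr \<tau>)
             \<ge> C * real (num_edges G) powr (\<tau> + (1 - \<tau>) / \<alpha>)"
proof -
  \<comment> \<open>The outer 2 cancels the 2 of the handshake bound \<open>2 * m / D\<close>; the
    factor \<open>2 * c\<close> is what turns the sparsity bound on the heavy vertices into exactly
    \<open>m / 2\<close>.\<close>
  define K where "K = 2 * (2 * c) powr (1 / \<alpha>)"
  have "K > 0"
    using assms by (simp add: K_def)
  show ?thesis
  \<comment> \<open>The power of \<open>K\<close> is its share in
    \<open>D powr (\<tau> - 1)\<close>; the 1/2 is the fraction of \<open>m\<close> guaranteed to
    the light degrees.\<close>
  proof (intro exI[of _ "K powr (\<tau> - 1) / 2"] conjI allI impI)
    show "K powr (\<tau> - 1) / 2 > 0"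
      using \<open>K > 0\<close> by simp
  next
    fix G :: "'a graph"
    assume G: "finite_simple_graph G"
      and sparse: "\<forall>S \<subseteq> verts G.
        real (num_edges (induced_subgraph G S)) \<le> c * real (card S) powr \<alpha>"
    define m where "m = real (num_edges G)"
    show "(\<Sum>v\<in>verts G. real (degree G v) powr \<tau>)
        \<ge> K powr (\<tau> - 1) / 2 * real (num_edges G) powr (\<tau> + (1 - \<tau>) / \<alpha>)"
    \<comment> \<open>Without edges \<open>D\<close> would be 0 and could not be divided by; the
      claimed lower bound is then 0.\<close>
    proof (cases "m = 0")
      case True
      then show ?thesis
        by (simp add: m_def sum_nonneg)
    next
      case False
      then have "m > 0"
        by (simp add: m_def)
      define D where "D = K * m powr (1 - 1 / \<alpha>)"
      define H where "H = {v \<in> verts G. D < real (degree G v)}"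
      have "D > 0"
        using \<open>K > 0\<close> \<open>m > 0\<close> by (simp add: D_def)
      have "real (card H) \<le> 2 * m / D"
        using card_high_degree_le[OF G, of D] \<open>D > 0\<close> by (simp add: H_def m_def field_simps)
      also have "\<dots> = (m / (2 * c)) powr (1 / \<alpha>)"
        using \<open>m > 0\<close> assms by (simp add: D_def K_def powr_diff powr_divide)
      finally have "real (card H) powr \<alpha> \<le> ((m / (2 * c)) powr (1 / \<alpha>)) powr \<alpha>"
        using assms by (intro powr_mono2) auto
      also have "\<dots> = m / (2 * c)"
        using \<open>m > 0\<close> assms by (simp add: powr_powr)
      finally have "c * real (card H) powr \<alpha> \<le> m / 2"
        using assms by (simp add: field_simps)
      moreover have "real (num_edges (induced_subgraph G H)) \<le> c * real (card H) powr \<alpha>"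
        using sparse by (simp add: H_def)
      moreover have "m \<le> real (num_edges (induced_subgraph G H))
          + (\<Sum>v\<in>verts G - H. real (degree G v))"
        unfolding m_def using num_edges_le_induced_plus_sum_degree[OF G, of H]
        by (metis of_nat_add of_nat_mono of_nat_sum)
      ultimately have light: "m / 2 \<le> (\<Sum>v\<in>verts G - H. real (degree G v))"
        by linarith
      \<comment> \<open>The exponent of \<open>m\<close> in the product of
        \<open>D powr (\<tau> - 1)\<close> and \<open>m / 2\<close>.\<close>
      have "\<tau> + (1 - \<tau>) / \<alpha> = (1 - 1 / \<alpha>) * (\<tau> - 1) + 1"
        using assms by (simp add: field_simps)
      then have "K powr (\<tau> - 1) / 2 * m powr (\<tau> + (1 - \<tau>) / \<alpha>) = D powr (\<tau> - 1) * (m / 2)"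
        using \<open>K > 0\<close> \<open>m > 0\<close> by (simp add: D_def powr_mult powr_powr powr_add)
      also have "\<dots> \<le> D powr (\<tau> - 1) * (\<Sum>v\<in>verts G - H. real (degree G v))"
        using light by (intro mult_left_mono) auto
      also have "\<dots> = (\<Sum>v\<in>verts G - H. D powr (\<tau> - 1) * real (degree G v))"
        by (rule sum_distrib_left)
      also have "\<dots> \<le> (\<Sum>v\<in>verts G - H. real (degree G v) powr \<tau>)"
        using assms by (intro sum_mono powr_ge_linear) (auto simp: H_def)
      also have "\<dots> \<le> (\<Sum>v\<in>verts G. real (degree G v) powr \<tau>)"
        using G by (intro sum_mono2) (auto simp: finite_simple_graph_def)
      finally show ?thesis
        by (simp add: m_def)
    qed
  qed
qed

end
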